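(* Let $M,N$ be terms of the extended stack calculus which both have a proper head normal form. If $M\not\sim N$, then $M$ and $N$ are separable.
   Context: The extended stack calculus. Stack variables $\alpha,\beta,\gamma,\ldots$. Stacks $\pi ::= \mathsf{nil}\mid\alpha\mid\mathsf{cdr}(\pi)\mid M::\pi$; terms $M ::= \mathsf{car}(\pi)\mid\mu\alpha.M\mid M\star\pi$ ($\star$ left-associative, precedence over $\mu$; $::$ right-associative, binding tighter than $\star$; $\mu\alpha_1\ldots\alpha_k.M\star\pi_1\star\cdots\star\pi_m$ abbreviates $\mu\alpha_1\ldots\mu\alpha_k.(M\star\pi_1\star\cdots\star\pi_m)$). $E\{\pi/\alpha\}$ is capture-avoiding substitution. Reductions: $(\mu\alpha.M)\star\pi\to M\{\pi/\alpha\}$, $\mathsf{car}(M::\pi)\to M$, $\mathsf{cdr}(M::\pi)\to\pi$; $=_s$ is the equivalence closure of their contextual closure. $\mathsf{cdr}^n$ is $n$-fold $\mathsf{cdr}$; $\mathsf{car}_n(\pi):=\mathsf{car}(\mathsf{cdr}^n(\pi))$. Canonical form: normal form w.r.t. the $\mathsf{car},\mathsf{cdr}$ rules. Head reduction: $M\to_h\mu\vec\alpha.N\{\varpi/\beta\}\star\vec\pi$ if $\mu\vec\alpha.(\mu\beta.N)\star\varpi\star\vec\pi$ is the canonical form of $M$ (no contextual closure). A hnf is a non-$\to_h$-reducible term $\mu\vec\alpha.H\star\vec\pi$, proper if $H=\mathsf{car}_n(\beta)$ and improper if $H=\mathsf{car}_n(\mathsf{nil})$; $\mathrm{hnf}(M)$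 is the hnf reached from $M$ by $\to_h$, if it exists; $M$ has a proper hnf if $\mathrm{hnf}(M)$ is defined and proper. Head contexts: $C[\cdot]::=[\cdot]\mid C[\cdot]\star\pi\mid\mu\alpha.C[\cdot]$. $\mathbf T:=\mu\alpha.\mathsf{car}_0(\alpha)\star\mathsf{cdr}^2(\alpha)$, $\mathbf F:=\mu\alpha.\mathsf{car}_1(\alpha)\star\mathsf{cdr}^2(\alpha)$; $M,N$ are separable if some head context $C$ has $C[M]=_s\mathbf T$ and $C[N]=_s\mathbf F$. Similarity of stacks $\sim_s$: the smallest equivalence relation on stacks containing $=_s$ such that (1) $\pi\sim_s M_1::\cdots::M_m::\mathsf{cdr}^k(\mathsf{nil})$ for every stack $\pi$, terms $M_i$ and $m,k\ge0$; (2) if $k-m=k'-m'$ then $M_1::\cdots::M_m::\mathsf{cdr}^k(\gamma)\sim_s N_1::\cdots::N_{m'}::\mathsf{cdr}^{k'}(\gamma)$. Similarity of terms $\sim$: the smallest equivalence relation on terms containing $=_s$ such that (1) if $k-m=k'-m'$, $\pi_i\sim_s\varpi_i$ for all $i=1,\ldots,\min\{m,m'\}$, and $\varpi_{\min\{m,m'\}+j}\sim_s\alpha_{\min\{k,k'\}+j}$ for all $j=1,\ldots,\max\{k,k'\}-\min\{k,k'\}$, then $\mu\alpha_1\ldots\alpha_k.\mathsf{car}_n(\beta)\star\pi_1\star\cdots\star\pi_m\sim\mu\alpha_1\ldots\alpha_{k'}.\mathsf{car}_n(\beta)\star\varpi_1\star\cdots\star\varpi_{m'}$; (2) if $\mathrm{hnf}(M)$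 and $\mathrm{hnf}(N)$ are both defined and improper then $M\sim N$; (3) if $\mathrm{hnf}(M)$ and $\mathrm{hnf}(N)$ are both undefined then $M\sim N$. *)

theory Defs
  imports Main
begin

text \<open>Terms modulo alpha-equivalence are represented with de Bruijn indices: \<open>SVar i\<close> refers to the
  \<open>i\<close>-th enclosing \<open>Mu\<close>, counted from the innermost one, and indices pointing beyond all
  enclosing binders are free stack variables.\<close>

datatype stack = SNil | SVar nat | SCdr stack | SCons trm stack
  and trm = Car stack | Mu trm | App trm stack  (infixl "\<star>" 75)

primrec lift_stack :: "nat \<Rightarrow> stack \<Rightarrow> stack" and lift_trm :: "nat \<Rightarrow> trm \<Rightarrow> trm" where
  "lift_stack c SNil = SNil"
| "lift_stack c (SVar i) = (if i < c then SVar i else SVar (Suc i))"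
| "lift_stack c (SCdr p) = SCdr (lift_stack c p)"
| "lift_stack c (SCons M p) = SCons (lift_trm c M) (lift_stack c p)"
| "lift_trm c (Car p) = Car (lift_stack c p)"
| "lift_trm c (Mu M) = Mu (lift_trm (Suc c) M)"
| "lift_trm c (M \<star> p) = lift_trm c M \<star> lift_stack c p"

text \<open>\<open>subst_trm v j M\<close> replaces the variable \<open>j\<close> of \<open>M\<close> by \<open>v\<close> and removes the binder of \<open>j\<close>:
  indices above \<open>j\<close> are decremented.\<close>

primrec subst_stack :: "stack \<Rightarrow> nat \<Rightarrow> stack \<Rightarrow> stack"
  and subst_trm :: "stack \<Rightarrow> nat \<Rightarrow> trm \<Rightarrow> trm" where
  "subst_stack v j SNil = SNil"
| "subst_stack v j (SVar i) = (if i < j then SVar i else if i = j then v else SVar (i - 1))"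
| "subst_stack v j (SCdr p) = SCdr (subst_stack v j p)"
| "subst_stack v j (SCons M p) = SCons (subst_trm v j M) (subst_stack v j p)"
| "subst_trm v j (Car p) = Car (subst_stack v j p)"
| "subst_trm v j (Mu M) = Mu (subst_trm (lift_stack 0 v) (Suc j) M)"
| "subst_trm v j (M \<star> p) = subst_trm v j M \<star> subst_stack v j p"

definition cdrs :: "nat \<Rightarrow> stack \<Rightarrow> stack" where
  "cdrs n p = (SCdr ^^ n) p"

definition car_nth :: "nat \<Rightarrow> stack \<Rightarrow> trm" where
  "car_nth n p = Car (cdrs n p)"

definition conses :: "trm list \<Rightarrow> stack \<Rightarrow> stack" where
  "conses Ms p = foldr SCons Ms p"

definition apps :: "trm \<Rightarrow> stack list \<Rightarrow> trm" where
  "apps M ps = foldl App M ps"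

definition mus :: "nat \<Rightarrow> trm \<Rightarrow> trm" where
  "mus k M = (Mu ^^ k) M"


section \<open>Reduction\<close>

inductive proj_stack :: "stack \<Rightarrow> stack \<Rightarrow> bool" where
  "proj_stack (SCdr (SCons M p)) p"

inductive proj_trm :: "trm \<Rightarrow> trm \<Rightarrow> bool" where
  "proj_trm (Car (SCons M p)) M"

inductive mu_proj_trm :: "trm \<Rightarrow> trm \<Rightarrow> bool" where
  mu: "mu_proj_trm (Mu M \<star> p) (subst_trm p 0 M)"
| car: "proj_trm M N \<Longrightarrow> mu_proj_trm M N"

text \<open>Contextual closure of a pair of relations on stacks and terms.\<close>

inductive ctxt_stack :: "(stack \<Rightarrow> stack \<Rightarrow> bool) \<Rightarrow> (trm \<Rightarrow> trm \<Rightarrow> bool) \<Rightarrow> stack \<Rightarrow> stack \<Rightarrow> bool"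
  and ctxt_trm :: "(stack \<Rightarrow> stack \<Rightarrow> bool) \<Rightarrow> (trm \<Rightarrow> trm \<Rightarrow> bool) \<Rightarrow> trm \<Rightarrow> trm \<Rightarrow> bool"
  for R :: "stack \<Rightarrow> stack \<Rightarrow> bool" and S :: "trm \<Rightarrow> trm \<Rightarrow> bool" where
  base_stack: "R p q \<Longrightarrow> ctxt_stack R S p q"
| cdr: "ctxt_stack R S p q \<Longrightarrow> ctxt_stack R S (SCdr p) (SCdr q)"
| cons_head: "ctxt_trm R S M N \<Longrightarrow> ctxt_stack R S (SCons M p) (SCons N p)"
| cons_tail: "ctxt_stack R S p q \<Longrightarrow> ctxt_stack R S (SCons M p) (SCons M q)"
| base_trm: "S M N \<Longrightarrow> ctxt_trm R S M N"
| car: "ctxt_stack R S p q \<Longrightarrow> ctxt_trm R S (Car p) (Car q)"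
| mu: "ctxt_trm R S M N \<Longrightarrow> ctxt_trm R S (Mu M) (Mu N)"
| app_fun: "ctxt_trm R S M N \<Longrightarrow> ctxt_trm R S (M \<star> p) (N \<star> p)"
| app_arg: "ctxt_stack R S p q \<Longrightarrow> ctxt_trm R S (M \<star> p) (M \<star> q)"

definition eq_stack :: "stack \<Rightarrow> stack \<Rightarrow> bool"  (infix "=\<^sub>\<pi>" 50) where
  "eq_stack = equivclp (ctxt_stack proj_stack mu_proj_trm)"

definition eq_trm :: "trm \<Rightarrow> trm \<Rightarrow> bool"  (infix "=\<^sub>s" 50) where
  "eq_trm = equivclp (ctxt_trm proj_stack mu_proj_trm)"


section \<open>Canonical forms and head reduction\<close>

definition canonical_form_of :: "trm \<Rightarrow> trm \<Rightarrow> bool" where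
  "canonical_form_of M P \<longleftrightarrow>
     (ctxt_trm proj_stack proj_trm)\<^sup>*\<^sup>* M P \<and> \<not> (\<exists>Q. ctxt_trm proj_stack proj_trm P Q)"

inductive head_red :: "trm \<Rightarrow> trm \<Rightarrow> bool"  (infix "\<rightarrow>\<^sub>h" 50) where
  "canonical_form_of M (mus k (apps (Mu N \<star> p) ps)) \<Longrightarrow>
     M \<rightarrow>\<^sub>h mus k (apps (subst_trm p 0 N) ps)"

definition head_normal :: "trm \<Rightarrow> bool" where
  "head_normal M \<longleftrightarrow> \<not> (\<exists>N. M \<rightarrow>\<^sub>h N)"

definition proper_hnf :: "trm \<Rightarrow> bool" where
  "proper_hnf M \<longleftrightarrow>
     head_normal M \<and> (\<exists>k n i ps. M = mus k (apps (car_nth n (SVar i)) ps))"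

definition improper_hnf :: "trm \<Rightarrow> bool" where
  "improper_hnf M \<longleftrightarrow>
     head_normal M \<and> (\<exists>k n ps. M = mus k (apps (car_nth n SNil) ps))"

text \<open>Head reduction only sees terms up to canonical form, and a term that is not head reducible has
  the shape of a hnf only once it is in canonical form; for instance \<open>Car (SCons (Car (SVar i)) p)\<close> is
  not head reducible. Accordingly the hnf of \<open>M\<close> is the canonical form of the irreducible term
  reached from \<open>M\<close>.\<close>

definition hnf_of :: "trm \<Rightarrow> trm \<Rightarrow> bool" where
  "hnf_of M H \<longleftrightarrow>
     (\<exists>M'. head_red\<^sup>*\<^sup>* M M' \<and> canonical_form_of M' H) \<and> (proper_hnf H \<or> improper_hnf H)"

definition has_hnf :: "trm \<Rightarrow> bool" where
  "has_hnf M \<longleftrightarrow> (\<exists>H. hnf_of M H)"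

definition has_proper_hnf :: "trm \<Rightarrow> bool" where
  "has_proper_hnf M \<longleftrightarrow> (\<exists>H. hnf_of M H \<and> proper_hnf H)"

definition has_improper_hnf :: "trm \<Rightarrow> bool" where
  "has_improper_hnf M \<longleftrightarrow> (\<exists>H. hnf_of M H \<and> improper_hnf H)"


section \<open>Separability\<close>

datatype head_ctxt = Hole | CApp head_ctxt stack | CMu head_ctxt

text \<open>Filling the hole may capture free variables of \<open>M\<close>, hence nothing is lifted.\<close>

primrec fill :: "head_ctxt \<Rightarrow> trm \<Rightarrow> trm" where
  "fill Hole M = M"
| "fill (CApp C p) M = fill C M \<star> p"
| "fill (CMu C) M = Mu (fill C M)"

definition true_trm :: trm  ("\<^bold>T") where
  "\<^bold>T = Mu (car_nth 0 (SVar 0) \<star> cdrs 2 (SVar 0))"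

definition false_trm :: trm  ("\<^bold>F") where
  "\<^bold>F = Mu (car_nth 1 (SVar 0) \<star> cdrs 2 (SVar 0))"

definition separable :: "trm \<Rightarrow> trm \<Rightarrow> bool" where
  "separable M N \<longleftrightarrow> (\<exists>C. fill C M =\<^sub>s \<^bold>T \<and> fill C N =\<^sub>s \<^bold>F)"


section \<open>Similarity\<close>

inductive sim_stack :: "stack \<Rightarrow> stack \<Rightarrow> bool"  (infix "\<sim>\<^sub>s" 50) where
  eq: "p =\<^sub>\<pi> q \<Longrightarrow> p \<sim>\<^sub>s q"
| sym: "p \<sim>\<^sub>s q \<Longrightarrow> q \<sim>\<^sub>s p"
| trans: "p \<sim>\<^sub>s q \<Longrightarrow> q \<sim>\<^sub>s r \<Longrightarrow> p \<sim>\<^sub>s r"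
| nil: "p \<sim>\<^sub>s conses Ms (cdrs k SNil)"
| var: "int k - int (length Ms) = int k' - int (length Ns) \<Longrightarrow>
     conses Ms (cdrs k (SVar i)) \<sim>\<^sub>s conses Ns (cdrs k' (SVar i))"

text \<open>In rule \<open>head\<close> the two sides have the binders \<open>\<alpha>\<^sub>1 \<dots> \<alpha>\<^sub>k\<close> and \<open>\<alpha>\<^sub>1 \<dots> \<alpha>\<^sub>k'\<close>; by symmetry we take
  \<open>k \<le> k'\<close>. The body of the left-hand side lives under \<open>k' - k\<close> fewer binders, so its components
  are lifted by \<open>k' - k\<close> to be compared with those of the right-hand side; in particular
  \<open>\<alpha>\<^sub>k\<^sub>+\<^sub>1, \<dots>, \<alpha>\<^sub>k'\<close> do not occur in it. Below the binders \<open>\<alpha>\<^sub>1 \<dots> \<alpha>\<^sub>k'\<close>, the variable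
  \<open>\<alpha>\<^sub>k\<^sub>+\<^sub>j\<close> has index \<open>k' - (k + j)\<close>. Stacks are numbered from 1 on paper and from 0 in lists.\<close>

inductive sim_trm :: "trm \<Rightarrow> trm \<Rightarrow> bool"  (infix "\<sim>" 50) where
  eq: "M =\<^sub>s N \<Longrightarrow> M \<sim> N"
| sym: "M \<sim> N \<Longrightarrow> N \<sim> M"
| trans: "M \<sim> N \<Longrightarrow> N \<sim> P \<Longrightarrow> M \<sim> P"
| head: "\<lbrakk>k \<le> k'; int k - int (length ps) = int k' - int (length qs);
     \<And>i. i < length ps \<Longrightarrow> (lift_stack 0 ^^ (k' - k)) (ps ! i) \<sim>\<^sub>s qs ! i;
     \<And>j. 1 \<le> j \<Longrightarrow> j \<le> k' - k \<Longrightarrow> qs ! (length ps + j - 1) \<sim>\<^sub>s SVar (k' - (k + j))\<rbrakk> \<Longrightarrow>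
     mus k (apps (car_nth n (SVar b)) ps) \<sim>
     mus k' (apps (car_nth n (SVar (b + (k' - k)))) qs)"
| improper: "has_improper_hnf M \<Longrightarrow> has_improper_hnf N \<Longrightarrow> M \<sim> N"
| no_hnf: "\<not> has_hnf M \<Longrightarrow> \<not> has_hnf N \<Longrightarrow> M \<sim> N"

end

theory Submission
  imports Defs
begin

text \<open>Since every stack is similar to \<open>nil\<close> and \<open>\<sim>\<^sub>s\<close> is an equivalence, \<open>\<sim>\<^sub>s\<close> relates all stacks.
  Hence two proper hnfs \<open>\<mu>\<alpha>\<^sub>1\<dots>\<alpha>\<^sub>k. car\<^sub>n(\<beta>) \<star> \<pi>\<^sub>1 \<star> \<dots> \<star> \<pi>\<^sub>m\<close> are dissimilar only if their heads differ or
  their values of \<open>k - m\<close> do. A head context first binds all free variables that occur in head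
  position, then applies closed stacks to saturate the binders, which leaves a closed term of our choice
  applied to unknown arguments. Different heads receive different constant functions. If the heads
  agree, the numbers of arguments differ, and a term that drops the larger number of arguments and
  returns the first entry of the next stack tells them apart by means of further stacks supplied
  afterwards.\<close>

section \<open>Conversion\<close>

text \<open>Zigzags of \<open>R\<close>-steps map to zigzags of \<open>R'\<close>-steps along
  \<open>f\<close>; with a constructor for \<open>f\<close> this yields the congruence rules of
  conversion.\<close>

lemma equivclp_map:
  assumes "equivclp R x y" and "\<And>x y. R x y \<Longrightarrow> R' (f x) (f y)"
  shows "equivclp R' (f x) (f y)"
  using assms(1)
proof (induction rule: equivclp_induct)
  case base
  then show ?case by simp
next
  case (step y z)
  then show ?case
    by (metis assms(2) equivclp_sym equivclp_trans r_into_equivclp)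
qed

lemma eq_trm_refl [simp]: "M =\<^sub>s M"
  by (simp add: eq_trm_def)

lemma eq_stack_refl [simp]: "p =\<^sub>\<pi> p"
  by (simp add: eq_stack_def)

lemma eq_trm_sym: "M =\<^sub>s N \<Longrightarrow> N =\<^sub>s M"
  unfolding eq_trm_def by (rule equivclp_sym)

lemma eq_trm_trans [trans]: "M =\<^sub>s N \<Longrightarrow> N =\<^sub>s P \<Longrightarrow> M =\<^sub>s P"
  unfolding eq_trm_def by (rule equivclp_trans)

lemma eq_stack_trans [trans]: "p =\<^sub>\<pi> q \<Longrightarrow> q =\<^sub>\<pi> r \<Longrightarrow> p =\<^sub>\<pi> r"
  unfolding eq_stack_def by (rule equivclp_trans)

lemma eq_trm_beta: "Mu M \<star> p =\<^sub>s subst_trm p 0 M"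
  unfolding eq_trm_def
  by (intro r_into_equivclp ctxt_stack_ctxt_trm.base_trm mu_proj_trm.mu)

lemma eq_trm_Car_SCons: "Car (SCons M p) =\<^sub>s M"
  unfolding eq_trm_def
  by (intro r_into_equivclp ctxt_stack_ctxt_trm.base_trm mu_proj_trm.car proj_trm.intros)

lemma eq_stack_SCdr_SCons: "SCdr (SCons M p) =\<^sub>\<pi> p"
  unfolding eq_stack_def
  by (intro r_into_equivclp ctxt_stack_ctxt_trm.base_stack proj_stack.intros)

lemma eq_trm_App: "M =\<^sub>s N \<Longrightarrow> M \<star> p =\<^sub>s N \<star> p"
  unfolding eq_trm_def
  by (erule equivclp_map) (rule ctxt_stack_ctxt_trm.app_fun)

lemma eq_trm_Mu: "M =\<^sub>s N \<Longrightarrow> Mu M =\<^sub>s Mu N"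
  unfolding eq_trm_def
  by (erule equivclp_map) (rule ctxt_stack_ctxt_trm.mu)

lemma eq_trm_Car: "p =\<^sub>\<pi> q \<Longrightarrow> Car p =\<^sub>s Car q"
  unfolding eq_trm_def eq_stack_def
  by (erule equivclp_map) (rule ctxt_stack_ctxt_trm.car)

lemma eq_stack_SCdr: "p =\<^sub>\<pi> q \<Longrightarrow> SCdr p =\<^sub>\<pi> SCdr q"
  unfolding eq_stack_def
  by (erule equivclp_map) (rule ctxt_stack_ctxt_trm.cdr)

section \<open>Iterated applications, abstractions and projections\<close>

lemma apps_Nil [simp]: "apps M [] = M"
  by (simp add: apps_def)

lemma apps_Cons [simp]: "apps M (p # ps) = apps (M \<star> p) ps"
  by (simp add: apps_def)

lemma apps_append: "apps M (ps @ qs) = apps (apps M ps) qs"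
  by (simp add: apps_def)

lemma mus_0 [simp]: "mus 0 M = M"
  by (simp add: mus_def)

lemma mus_Suc [simp]: "mus (Suc k) M = Mu (mus k M)"
  by (simp add: mus_def)

lemma mus_add: "mus (k + l) M = mus k (mus l M)"
  by (simp add: mus_def funpow_add)

lemma eq_trm_apps: "M =\<^sub>s N \<Longrightarrow> apps M ps =\<^sub>s apps N ps"
  by (induction ps arbitrary: M N) (auto intro: eq_trm_App)

lemma eq_trm_mus: "M =\<^sub>s N \<Longrightarrow> mus k M =\<^sub>s mus k N"
  by (induction k) (auto intro: eq_trm_Mu)

lemma cdrs_conses_eq:
  "n \<le> length Ms \<Longrightarrow> cdrs n (conses Ms p) =\<^sub>\<pi> conses (drop n Ms) p"
proof (induction n)
  case 0
  then show ?case by (simp add: cdrs_def)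
next
  case (Suc n)
  then have "cdrs (Suc n) (conses Ms p) =\<^sub>\<pi> SCdr (conses (drop n Ms) p)"
    by (auto simp: cdrs_def intro: eq_stack_SCdr)
  also have "drop n Ms = Ms ! n # drop (Suc n) Ms"
    using Suc.prems by (simp add: Cons_nth_drop_Suc)
  then have "SCdr (conses (drop n Ms) p) =\<^sub>\<pi> conses (drop (Suc n) Ms) p"
    by (simp add: conses_def eq_stack_SCdr_SCons)
  finally show ?case .
qed

lemma car_nth_conses_eq:
  assumes "n < length Ms"
  shows "car_nth n (conses Ms p) =\<^sub>s Ms ! n"
proof -
  have "car_nth n (conses Ms p) =\<^sub>s Car (conses (drop n Ms) p)"
    unfolding car_nth_def using assms by (intro eq_trm_Car cdrs_conses_eq) simp
  also have "drop n Ms = Ms ! n # drop (Suc n) Ms"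
    using assms by (simp add: Cons_nth_drop_Suc)
  then have "Car (conses (drop n Ms) p) =\<^sub>s Ms ! n"
    by (simp add: conses_def eq_trm_Car_SCons)
  finally show ?thesis .
qed

section \<open>Head reduction as a special case of conversion\<close>

lemma ctxt_proj_imp_ctxt_mu_proj:
  "ctxt_stack proj_stack proj_trm p q \<Longrightarrow> ctxt_stack proj_stack mu_proj_trm p q"
  "ctxt_trm proj_stack proj_trm M N \<Longrightarrow> ctxt_trm proj_stack mu_proj_trm M N"
  by (induction rule: ctxt_stack_ctxt_trm.inducts)
    (auto intro: ctxt_stack_ctxt_trm.intros mu_proj_trm.intros)

lemma canonical_form_of_imp_eq:
  assumes "canonical_form_of M P"
  shows "M =\<^sub>s P"
proof -
  have "(ctxt_trm proj_stack proj_trm)\<^sup>*\<^sup>* M P"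
    using assms by (simp add: canonical_form_of_def)
  then show ?thesis
  proof (induction rule: rtranclp_induct)
    case (step P Q)
    have "P =\<^sub>s Q"
      unfolding eq_trm_def
      using step.hyps(2) by (intro r_into_equivclp ctxt_proj_imp_ctxt_mu_proj)
    with step.IH show ?case by (rule eq_trm_trans)
  qed simp
qed

lemma head_red_imp_eq:
  assumes "M \<rightarrow>\<^sub>h N"
  shows "M =\<^sub>s N"
  using assms
proof cases
  case (1 k N' p ps)
  then show ?thesis
    by (metis canonical_form_of_imp_eq eq_trm_apps eq_trm_beta eq_trm_mus eq_trm_trans)
qed

text \<open>Canonical forms and head steps are conversions. Separability is stated up to
  \<open>=\<^sub>s\<close>, so the given terms may be replaced by their hnfs.\<close>

lemma hnf_of_imp_eq:
  assumes "hnf_of M H"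
  shows "M =\<^sub>s H"
proof -
  obtain M' where M': "head_red\<^sup>*\<^sup>* M M'" "canonical_form_of M' H"
    using assms by (auto simp: hnf_of_def)
  from M'(1) have "M =\<^sub>s M'"
    by (induction rule: rtranclp_induct) (auto intro: eq_trm_trans head_red_imp_eq)
  then show ?thesis
    using M'(2) by (blast intro: eq_trm_trans canonical_form_of_imp_eq)
qed

section \<open>Closed terms and saturation of binders\<close>

text \<open>Closedness is encoded by the equations that rewriting needs, rather than by an absence
  of free variables.\<close>

definition closed_trm :: "trm \<Rightarrow> bool" where
  "closed_trm M \<longleftrightarrow> (\<forall>c. lift_trm c M = M) \<and> (\<forall>v j. subst_trm v j M = M)"

definition closed_stack :: "stack \<Rightarrow> bool" where
  "closed_stack p \<longleftrightarrow> (\<forall>c. lift_stack c p = p) \<and> (\<forall>v j. subst_stack v j p = p)"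

lemma closed_mus: "closed_trm M \<Longrightarrow> closed_trm (mus k M)"
  by (induction k) (auto simp: closed_trm_def)

lemma closed_true_trm: "closed_trm \<^bold>T"
  and closed_false_trm: "closed_trm \<^bold>F"
  and closed_Mu_Car: "closed_trm (Mu (Car (SVar 0)))"
  by (auto simp: closed_trm_def true_trm_def false_trm_def car_nth_def cdrs_def
      numeral_2_eq_2)

lemma closed_conses_SNil: "\<forall>M\<in>set Ms. closed_trm M \<Longrightarrow> closed_stack (conses Ms SNil)"
  by (induction Ms) (auto simp: closed_trm_def closed_stack_def conses_def)

lemma subst_stack_cdrs: "subst_stack v j (cdrs n p) = cdrs n (subst_stack v j p)"
  by (induction n) (auto simp: cdrs_def)

lemma subst_trm_car_nth: "subst_trm v j (car_nth n p) = car_nth n (subst_stack v j p)"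
  by (simp add: car_nth_def subst_stack_cdrs)

lemma subst_trm_apps: "subst_trm v j (apps M ps) = apps (subst_trm v j M) (map (subst_stack v j) ps)"
  by (induction ps arbitrary: M) auto

text \<open>A closed \<open>v\<close> is not changed by the lifting that occurs at each binder
  crossed.\<close>

lemma subst_trm_mus:
  "closed_stack v \<Longrightarrow> subst_trm v j (mus k M) = mus k (subst_trm v (j + k) M)"
  by (induction k arbitrary: j) (auto simp: closed_stack_def)

lemma apps_mus_Cons_eq:
  assumes "closed_stack s"
  shows "apps (mus (Suc K) (apps M ps)) (s # ss) =\<^sub>s
    apps (mus K (apps (subst_trm s K M) (map (subst_stack s K) ps))) ss"
proof -
  have "Mu (mus K (apps M ps)) \<star> s =\<^sub>s subst_trm s 0 (mus K (apps M ps))"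
    by (rule eq_trm_beta)
  then show ?thesis
    using assms by (auto simp: subst_trm_mus subst_trm_apps intro: eq_trm_apps)
qed

text \<open>The first \<open>K\<close> stacks of \<open>ss\<close> are consumed by the binders, the
  others become further arguments. Substitution alters the entries of \<open>ps\<close> but not
  their number, so only the length of \<open>rs\<close> is recorded.\<close>

lemma apps_mus_closed_head:
  assumes "\<forall>s\<in>set ss. closed_stack s" and "K \<le> length ss"
    and "\<And>v j. subst_trm v j M = M"
  shows "\<exists>rs. length rs = length ps + (length ss - K) \<and>
    apps (mus K (apps M ps)) ss =\<^sub>s apps M rs"
  using assms(1,2)
proof (induction K arbitrary: ss ps)
  case 0
  show ?case
    by (rule exI[of _ "ps @ ss"]) (simp add: apps_append)
next
  case (Suc K)
  then obtain s ss' where ss: "ss = s # ss'" by (cases ss) auto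
  have "apps (mus (Suc K) (apps M ps)) ss =\<^sub>s
      apps (mus K (apps M (map (subst_stack s K) ps))) ss'"
    using apps_mus_Cons_eq[of s K M ps ss'] Suc.prems(1) assms(3) ss by simp
  moreover obtain rs where
    "length rs = length (map (subst_stack s K) ps) + (length ss' - K)"
    "apps (mus K (apps M (map (subst_stack s K) ps))) ss' =\<^sub>s apps M rs"
    using Suc.IH[of ss'] Suc.prems ss by fastforce
  ultimately show ?case
    using ss by (auto intro: eq_trm_trans)
qed

text \<open>The outermost binder has index \<open>K - 1\<close> in the body and receives the first
  stack, hence index \<open>b\<close> receives the one at position \<open>K - Suc b\<close>. Once
  the head variable is replaced by a closed stack, the previous lemma consumes the remaining
  binders.\<close>

lemma apps_mus_car_nth_eq:
  assumes "\<forall>s\<in>set ss. closed_stack s" and "K \<le> length ss" and "b < K"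
  shows "\<exists>rs. length rs = length ps + (length ss - K) \<and>
    apps (mus K (apps (car_nth n (SVar b)) ps)) ss =\<^sub>s apps (car_nth n (ss ! (K - Suc b))) rs"
  using assms
proof (induction K arbitrary: ss ps)
  case 0
  then show ?case by simp
next
  case (Suc K)
  then obtain s ss' where ss: "ss = s # ss'" by (cases ss) auto
  let ?ps = "map (subst_stack s K) ps"
  have s: "closed_stack s" using Suc.prems(1) ss by simp
  have *: "apps (mus (Suc K) (apps (car_nth n (SVar b)) ps)) ss =\<^sub>s
      apps (mus K (apps (car_nth n (subst_stack s K (SVar b))) ?ps)) ss'"
    using apps_mus_Cons_eq[OF s, of K "car_nth n (SVar b)" ps ss']
    by (simp only: ss subst_trm_car_nth)
  show ?case
  proof (cases "b = K")
    case True
    obtain rs where "length rs = length ?ps + (length ss' - K)"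
      "apps (mus K (apps (car_nth n s) ?ps)) ss' =\<^sub>s apps (car_nth n s) rs"
      using apps_mus_closed_head[of ss' K "car_nth n s" ?ps] s Suc.prems ss
      by (auto simp: subst_trm_car_nth closed_stack_def)
    then show ?thesis
      using * True ss by (auto intro: eq_trm_trans)
  next
    case False
    then have b: "b < K" using Suc.prems(3) by simp
    obtain rs where "length rs = length ?ps + (length ss' - K)"
      "apps (mus K (apps (car_nth n (SVar b)) ?ps)) ss' =\<^sub>s
        apps (car_nth n (ss' ! (K - Suc b))) rs"
      using Suc.IH[of ss' ?ps] Suc.prems ss b by auto
    moreover have "ss ! (Suc K - Suc b) = ss' ! (K - Suc b)"
      using b ss by (simp add: nth_Cons')
    ultimately show ?thesis
      using * b ss by (auto intro: eq_trm_trans)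
  qed
qed

lemma apps_mus_erase:
  assumes "closed_trm A" and "length rs = k"
  shows "apps (mus k A) rs =\<^sub>s A"
  using assms(2)
proof (induction rs arbitrary: k)
  case (Cons r rs)
  then obtain l where l: "k = Suc l" "length rs = l" by auto
  have "Mu (mus l A) \<star> r =\<^sub>s mus l A"
    using eq_trm_beta[of "mus l A" r] closed_mus[OF assms(1), of l] by (simp add: closed_trm_def)
  then show ?case
    using l Cons.IH by (auto intro: eq_trm_trans eq_trm_apps)
qed simp

section \<open>Separation\<close>

text \<open>\<open>X\<close> drops \<open>a'\<close> stacks and returns the first entry of the next
  one. After \<open>a'\<close> arguments that next stack is the first of \<open>es\<close>; after
  \<open>a\<close> arguments it is the last.\<close>

lemma arity_separation_less:
  assumes A: "closed_trm A" and B: "closed_trm B" and less: "a < a'"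
  shows "\<exists>X es. closed_trm X \<and>
    (\<forall>rs rs'. length rs = a \<longrightarrow> length rs' = a' \<longrightarrow>
      apps X (rs @ es) =\<^sub>s A \<and> apps X (rs' @ es) =\<^sub>s B)"
proof -
  let ?P = "Mu (Car (SVar 0))"
  define d where "d = a' - a - 1"
  let ?es = "SCons (mus (Suc d) B) SNil # replicate d SNil @ [SCons A SNil]"
  have P: "?P \<star> SCons M SNil =\<^sub>s M" for M
    using eq_trm_beta[of "Car (SVar 0)" "SCons M SNil"] eq_trm_Car_SCons[of M SNil]
    by (auto intro: eq_trm_trans)
  have drop: "apps (mus a' ?P) (rs @ [SCons M SNil]) =\<^sub>s M" if "length rs = a'" for rs M
    using eq_trm_App[OF apps_mus_erase[OF closed_Mu_Car that]] P
    by (auto simp: apps_append intro: eq_trm_trans)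
  \<comment> \<open>All of \<open>es\<close> but its last stack, \<open>1 + d = a' - a\<close>
    stacks, complete \<open>rs\<close> to the \<open>a'\<close> stacks that are dropped.\<close>
  have "apps (mus a' ?P) (rs @ ?es) =\<^sub>s A" if "length rs = a" for rs
    using drop[of "rs @ SCons (mus (Suc d) B) SNil # replicate d SNil" A] that less
    by (simp add: d_def)
  moreover have "apps (mus a' ?P) (rs @ ?es) =\<^sub>s B" if "length rs = a'" for rs
  proof -
    \<comment> \<open>These \<open>d + 1\<close> stacks are left over; the entry
      \<open>mus (Suc d) B\<close> just returned discards them.\<close>
    let ?fs = "replicate d SNil @ [SCons A SNil]"
    have "apps (mus a' ?P) (rs @ ?es) =\<^sub>s apps (mus (Suc d) B) ?fs"
      using eq_trm_apps[OF drop[OF that], of "mus (Suc d) B" ?fs] by (simp add: apps_append)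
    also have "apps (mus (Suc d) B) ?fs =\<^sub>s B"
      by (rule apps_mus_erase[OF B]) simp
    finally show ?thesis .
  qed
  ultimately show ?thesis
    using closed_mus[OF closed_Mu_Car] by blast
qed

lemma arity_separation:
  assumes "closed_trm A" and "closed_trm B" and "a \<noteq> a'"
  obtains X es where "closed_trm X"
    and "\<And>rs. length rs = a \<Longrightarrow> apps X (rs @ es) =\<^sub>s A"
    and "\<And>rs. length rs = a' \<Longrightarrow> apps X (rs @ es) =\<^sub>s B"
proof -
  \<comment> \<open>Lists of every length exist, so the joint statement about \<open>rs\<close> and
    \<open>rs'\<close> splits into its two halves.\<close>
  have witness: "length (replicate l SNil) = l" for l by simp
  consider "a < a'" | "a' < a" using assms(3) by linarith
  then show ?thesis
  proof cases
    case 1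
    from arity_separation_less[OF assms(1,2) 1] show ?thesis
      using that witness by metis
  next
    case 2
    from arity_separation_less[OF assms(2,1) 2] show ?thesis
      using that witness by metis
  qed
qed

lemma fill_apps_mus: "\<exists>C. \<forall>M. fill C M = apps (mus B M) ss"
proof -
  have "\<exists>C. \<forall>M. fill C M = mus B M"
  proof (induction B)
    case 0
    show ?case by (rule exI[of _ Hole]) simp
  next
    case (Suc B)
    then obtain C where "\<forall>M. fill C M = mus B M" ..
    then show ?case by (intro exI[of _ "CMu C"]) simp
  qed
  then show ?thesis
  proof (induction ss rule: rev_induct)
    case (snoc s ss)
    then obtain C where "\<forall>M. fill C M = apps (mus B M) ss" by auto
    then show ?case by (intro exI[of _ "CApp C s"]) (simp add: apps_append)
  qed simp
qed

text \<open>\<open>B\<close> outer binders are added to capture the free head variables; \<open>L\<close> is the common number of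
  stacks supplied to saturate all binders, and \<open>i\<close>, \<open>i'\<close> are the positions, among these stacks, of the
  ones that the two head variables receive.\<close>

lemma separable_hnf:
  assumes M: "M =\<^sub>s mus k (apps (car_nth n (SVar b)) ps)"
    and N: "N =\<^sub>s mus k' (apps (car_nth n' (SVar b')) qs)"
    and neq: "\<not> (n = n' \<and> int k - int b = int k' - int b' \<and>
      int k - int (length ps) = int k' - int (length qs))"
  shows "separable M N"
proof -
  define B where "B = Suc (b + b')"
  define L where "L = B + k + k'"
  define i where "i = B + k - Suc b"
  define i' where "i' = B + k' - Suc b'"
  \<comment> \<open>\<open>a\<close> and \<open>a'\<close> count the arguments left on each head
    after saturation: its own ones and the stacks in excess of its binders.\<close>
  define a where "a = length ps + (L - (B + k))"
  define a' where "a' = length qs + (L - (B + k'))"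
  have i: "i < L" "i' < L" by (auto simp: i_def i'_def L_def B_def)
  \<comment> \<open>\<open>X j l\<close> is to become entry \<open>l\<close> of the stack at
    position \<open>j\<close>; \<open>es\<close> are the stacks supplied afterwards.\<close>
  have "\<exists>X es. (\<forall>j l. closed_trm (X j l)) \<and>
    (\<forall>rs. length rs = a \<longrightarrow> apps (X i n) (rs @ es) =\<^sub>s \<^bold>T) \<and>
    (\<forall>rs. length rs = a' \<longrightarrow> apps (X i' n') (rs @ es) =\<^sub>s \<^bold>F)"
  proof (cases "i = i' \<and> n = n'")
    case True
    \<comment> \<open>No subtraction truncates, since \<open>b\<close> and \<open>b'\<close> are
      below \<open>B\<close>; likewise for \<open>a\<close> and \<open>a'\<close>, where
      \<open>L - (B + k)\<close> is \<open>k'\<close> and \<open>L - (B + k')\<close> is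
      \<open>k\<close>.\<close>
    have "i = i' \<longleftrightarrow> int k - int b = int k' - int b'"
      by (auto simp: i_def i'_def B_def)
    moreover have "a = a' \<longleftrightarrow> int k - int (length ps) = int k' - int (length qs)"
      by (auto simp: a_def a'_def L_def)
    ultimately have "a \<noteq> a'" using neq True by blast
    then obtain X es where "closed_trm X"
      "\<And>rs. length rs = a \<Longrightarrow> apps X (rs @ es) =\<^sub>s \<^bold>T"
      "\<And>rs. length rs = a' \<Longrightarrow> apps X (rs @ es) =\<^sub>s \<^bold>F"
      using arity_separation[OF closed_true_trm closed_false_trm] by metis
    then show ?thesis by (intro exI[of _ "\<lambda>_ _. X"] exI[of _ es]) simp
  next
    case False
    \<comment> \<open>The pairs \<open>(i, n)\<close> and \<open>(i', n')\<close> differ, so each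
      can be assigned its own constant function.\<close>
    then show ?thesis
      by (intro exI[of _ "\<lambda>j l. if j = i \<and> l = n then mus a \<^bold>T else mus a' \<^bold>F"] exI[of _ "[]"])
        (auto simp: closed_mus closed_true_trm closed_false_trm intro: apps_mus_erase)
  qed
  then obtain X es where X: "\<And>j l. closed_trm (X j l)"
    and T: "\<And>rs. length rs = a \<Longrightarrow> apps (X i n) (rs @ es) =\<^sub>s \<^bold>T"
    and F: "\<And>rs. length rs = a' \<Longrightarrow> apps (X i' n') (rs @ es) =\<^sub>s \<^bold>F"
    by blast
  \<comment> \<open>With \<open>n + n' + 1\<close> entries, both projections \<open>n\<close> and
    \<open>n'\<close> select an entry.\<close>
  define \<sigma> where "\<sigma> j = conses (map (X j) [0..<Suc (n + n')]) SNil" for j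
  define ss where "ss = map \<sigma> [0..<L]"
  have ss: "\<forall>s\<in>set ss. closed_stack s" "length ss = L"
    by (auto simp: ss_def \<sigma>_def X intro!: closed_conses_SNil)
  \<comment> \<open>The computation common to \<open>M\<close> and \<open>N\<close>:
    \<open>ss\<close> saturates the binders and puts an \<open>X j l\<close> in head
    position.\<close>
  have *: "\<exists>rs. length rs = length ts + (L - (B + h)) \<and>
      apps (mus B P) (ss @ es) =\<^sub>s apps (X (B + h - Suc c) l) (rs @ es)"
    if P: "P =\<^sub>s mus h (apps (car_nth l (SVar c)) ts)"
      and c: "c < B" and h: "B + h \<le> L" and l: "l \<le> n + n'" for P h l c ts
  proof -
    obtain rs where rs: "length rs = length ts + (L - (B + h))"
      "apps (mus (B + h) (apps (car_nth l (SVar c)) ts)) ss =\<^sub>s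
        apps (car_nth l (ss ! (B + h - Suc c))) rs"
      using apps_mus_car_nth_eq[of ss "B + h" c ts l] ss c h by auto
    have "ss ! (B + h - Suc c) = \<sigma> (B + h - Suc c)"
      using c h by (simp add: ss_def)
    moreover have "car_nth l (\<sigma> (B + h - Suc c)) =\<^sub>s X (B + h - Suc c) l"
      using car_nth_conses_eq[of l "map (X (B + h - Suc c)) [0..<Suc (n + n')]" SNil] l
      by (simp add: \<sigma>_def del: upt_Suc)
    ultimately have "apps (mus B P) ss =\<^sub>s apps (X (B + h - Suc c) l) rs"
      using rs(2) eq_trm_apps[OF eq_trm_mus[OF P, of B], of ss]
      by (metis eq_trm_apps eq_trm_trans mus_add)
    then show ?thesis
      using rs(1) by (auto simp: apps_append intro: eq_trm_apps)
  qed
  obtain C where C: "\<And>P. fill C P = apps (mus B P) (ss @ es)"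
    using fill_apps_mus by metis
  have "fill C M =\<^sub>s \<^bold>T"
    using *[OF M] T C by (force simp: B_def L_def i_def a_def intro: eq_trm_trans)
  moreover have "fill C N =\<^sub>s \<^bold>F"
    using *[OF N] F C by (force simp: B_def L_def i'_def a'_def intro: eq_trm_trans)
  ultimately show ?thesis
    by (auto simp: separable_def)
qed

section \<open>Similarity of stacks and of head normal forms\<close>

lemma sim_stack_total: "p \<sim>\<^sub>s q"
proof -
  have "p \<sim>\<^sub>s SNil" for p
    using sim_stack.nil[of p "[]" 0] by (simp add: conses_def cdrs_def)
  then show ?thesis
    by (blast intro: sim_stack.sym sim_stack.trans)
qed

text \<open>The conditions on stacks in rule \<open>head\<close> hold because all stacks are
  similar. For \<open>k \<le> k'\<close>, the first hypothesis is the index shift that the rule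
  demands; the other case follows by symmetry.\<close>

lemma sim_trm_hnf:
  assumes "int k - int b = int k' - int b'"
    and "int k - int (length ps) = int k' - int (length qs)"
  shows "mus k (apps (car_nth n (SVar b)) ps) \<sim> mus k' (apps (car_nth n (SVar b')) qs)"
  using assms
proof (induction k k' arbitrary: b b' ps qs rule: linorder_wlog)
  case (le k k')
  then have "b' = b + (k' - k)" by linarith
  then show ?case
    using sim_trm.head[OF le(1) le(3)] sim_stack_total by simp
next
  case (sym k k')
  then show ?case by (metis sim_trm.sym)
qed

theorem theorem8:
  fixes M N :: trm
  assumes "has_proper_hnf M" and "has_proper_hnf N"
    and "\<not> M \<sim> N"
  shows "separable M N"
proof -
  obtain k n b ps where M: "M =\<^sub>s mus k (apps (car_nth n (SVar b)) ps)"
    using assms(1) hnf_of_imp_eq by (fastforce simp: has_proper_hnf_def proper_hnf_def)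
  obtain k' n' b' qs where N: "N =\<^sub>s mus k' (apps (car_nth n' (SVar b')) qs)"
    using assms(2) hnf_of_imp_eq by (fastforce simp: has_proper_hnf_def proper_hnf_def)
  show ?thesis
  \<comment> \<open>It remains to exclude that the heads and both differences agree, as the two hnfs
    would then be similar.\<close>
  proof (rule separable_hnf[OF M N], safe)
    assume "n = n'" "int k - int b = int k' - int b'"
      "int k - int (length ps) = int k' - int (length qs)"
    then have "mus k (apps (car_nth n (SVar b)) ps) \<sim> mus k' (apps (car_nth n' (SVar b')) qs)"
      by (simp add: sim_trm_hnf)
    then have "M \<sim> N"
      using sim_trm.eq[OF M] sim_trm.eq[OF eq_trm_sym[OF N]] by (blast intro: sim_trm.trans)
    with assms(3) show False ..
  qed
qed

end
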